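(* Let $d\ge2$ be an integer and $j\in\{1,\ldots,d\}$. Then $R_{\mathrm{dis}}^{(jj)}$ is not bounded on $\ell^p(\mathbb Z^d)$ for any $1<p<\infty$. Moreover, $R_{\mathrm{dis}}^{(jj)}$ is not bounded from $\ell^1(\mathbb Z^d)$ to $\ell^{1,\infty}(\mathbb Z^d)$.
   Context: For an integer $d\ge2$ put $c_d=\Gamma\left(\frac{d+2}{2}\right)/\pi^{d/2}$, and let $|\cdot|$ be the Euclidean norm. For $j\in\{1,\ldots,d\}$ and $f:\mathbb Z^d\to\mathbb C$, $$R_{\mathrm{dis}}^{(jj)}f(n)=c_d\sum_{m\in\mathbb Z^d\setminus\{0\}}\frac{m_j^2}{|m|^{d+2}}f(n-m),\qquad n\in\mathbb Z^d.$$ The weak quasi-norm is $\|g\|_{\ell^{1,\infty}(\mathbb Z^d)}=\sup_{\tau>0}\tau\,\#\{n\in\mathbb Z^d:|g(n)|>\tau\}$; bounded from $\ell^1$ to $\ell^{1,\infty}$ means that there is $C<\infty$ with $\|Tf\|_{\ell^{1,\infty}}\le C\|f\|_{\ell^1}$ for all $f\in\ell^1(\mathbb Z^d)$. *)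

theory Defs
  imports "HOL-Analysis.Analysis"
begin

text \<open>
  The lattice \<open>\<int>\<^sup>d\<close> is rendered as the type \<^typ>\<open>int ^ 'd\<close> with \<open>d = CARD('d)\<close>.
\<close>

definition riesz_const :: "nat \<Rightarrow> real" where
  "riesz_const d = Gamma ((real d + 2) / 2) / pi powr (real d / 2)"

definition euclid_norm :: "int ^ 'd \<Rightarrow> real" where
  "euclid_norm m = norm (\<chi> i. real_of_int (m $ i))"

text \<open>
  The kernel is \<open>O(|m| powr -d)\<close>, hence it lies in \<open>\<ell>\<^sup>q\<close> for every \<open>q > 1\<close>. So for \<open>f \<in> \<ell>\<^sup>p\<close> with
  \<open>1 \<le> p < \<infinity>\<close> the series converges absolutely for every \<open>n\<close>, and the unordered sum
  below is its value. Where the family is not summable, \<^const>\<open>infsum\<close> is \<open>0\<close> by convention.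
\<close>

definition R_dis :: "'d \<Rightarrow> (int ^ 'd \<Rightarrow> complex) \<Rightarrow> int ^ 'd \<Rightarrow> complex" where
  "R_dis j f n =
     of_real (riesz_const CARD('d)) *
     (\<Sum>\<^sub>\<infinity>m\<in>UNIV - {0}.
        of_real ((real_of_int (m $ j))\<^sup>2 / euclid_norm m ^ (CARD('d) + 2)) * f (n - m))"

definition lp_space :: "real \<Rightarrow> ('a \<Rightarrow> complex) set" where
  "lp_space p = {f. (\<lambda>n. cmod (f n) powr p) summable_on UNIV}"

text \<open>Only meaningful on \<^const>\<open>lp_space\<close>: the sum of a non-summable family is \<open>0\<close>.\<close>

definition lp_norm :: "real \<Rightarrow> ('a \<Rightarrow> complex) \<Rightarrow> real" where
  "lp_norm p f = (\<Sum>\<^sub>\<infinity>n. cmod (f n) powr p) powr (1 / p)"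

definition weak_l1_norm :: "('a \<Rightarrow> complex) \<Rightarrow> ennreal" where
  "weak_l1_norm g =
     (SUP \<tau>\<in>{0<..}. ennreal \<tau> * emeasure (count_space UNIV) {n. cmod (g n) > \<tau>})"

definition bounded_on_lp :: "real \<Rightarrow> (('a \<Rightarrow> complex) \<Rightarrow> 'a \<Rightarrow> complex) \<Rightarrow> bool" where
  "bounded_on_lp p T \<longleftrightarrow>
     (\<exists>C::real. \<forall>f\<in>lp_space p. T f \<in> lp_space p \<and> lp_norm p (T f) \<le> C * lp_norm p f)"

definition bounded_l1_weak_l1 :: "(('a \<Rightarrow> complex) \<Rightarrow> 'a \<Rightarrow> complex) \<Rightarrow> bool" where
  "bounded_l1_weak_l1 T \<longleftrightarrow>
     (\<exists>C::real. \<forall>f\<in>lp_space 1. weak_l1_norm (T f) \<le> ennreal (C * lp_norm 1 f))"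

end

theory Submission imports Defs begin

text \<open>
  The kernel \<open>m\<^sub>j\<^sup>2 / |m|\<^bsup>d+2\<^esup>\<close> is nonnegative and of size \<open>|m|\<^bsup>-d\<^esup>\<close>
  in a cone around the \<open>j\<close>-th axis. Such a kernel just fails to be summable:
  its sum \<open>S N\<close> over the punctured cube \<open>{-N..N}\<^sup>d - {0}\<close> grows like \<open>log N\<close>
  (\<open>kernel_sum_unbounded\<close>).

  Test the operator on the indicator of the cube of
  radius \<open>2 N\<close>. For \<open>n\<close> in the cube of radius \<open>N\<close>, all translates \<open>n - m\<close> with \<open>m\<close> in that
  same cube lie in the support of the indicator; since no term is negative,
  the operator takes a value of at least \<open>c\<^sub>d * S N\<close> at \<open>n\<close> (\<open>R_dis_cube_lower\<close>).
  The two cubes have comparable cardinalities, with ratio at most \<open>2\<^sup>d\<close> (\<open>card_cube_double\<close>), so a strong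
  or weak bound with constant \<open>C\<close> would give a bound on \<open>c\<^sub>d * S N\<close> by \<open>C\<close> times a factor that does not depend on
  \<open>N\<close>, which is absurd.
\<close>

section \<open>Cubes in the integer lattice\<close>

lemma card_box:
  fixes A :: "'d::finite \<Rightarrow> 'a set"
  shows "card {m :: 'a ^ 'd. \<forall>i. m $ i \<in> A i} = (\<Prod>i\<in>UNIV. card (A i))"
proof -
  have "bij_betw vec_nth {m :: 'a ^ 'd. \<forall>i. m $ i \<in> A i} (Pi\<^sub>E UNIV A)"
    by (rule bij_betwI[where g = vec_lambda]) (auto simp: PiE_def)
  then show ?thesis
    by (simp add: bij_betw_same_card card_PiE)
qed

definition cube :: "nat \<Rightarrow> (int ^ 'd) set" where
  "cube N = {m. \<forall>i. m $ i \<in> {- int N..int N}}"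

lemma card_cube: "card (cube N :: (int ^ 'd::finite) set) = (2 * N + 1) ^ CARD('d)"
proof -
  have "nat (2 * int N + 1) = Suc (2 * N)"
    by linarith
  then show ?thesis
    unfolding cube_def card_box by simp
qed

lemma finite_cube: "finite (cube N :: (int ^ 'd::finite) set)"
  by (rule card_ge_0_finite) (simp add: card_cube)

lemma card_cube_double:
  "real (card (cube (2 * N) :: (int ^ 'd::finite) set)) \<le> 2 ^ CARD('d) * real (card (cube N :: (int ^ 'd) set))"
proof -
  have "real (2 * (2 * N) + 1) ^ CARD('d) \<le> (2 * real (2 * N + 1)) ^ CARD('d)"
    by (rule power_mono) auto
  then show ?thesis
    unfolding card_cube of_nat_power power_mult_distrib .
qed

lemma diff_in_cube_double:
  assumes "n \<in> cube N" "m \<in> cube N"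
  shows "n - m \<in> cube (2 * N)"
  unfolding cube_def
proof (clarify)
  fix i
  have "n $ i \<in> {- int N..int N}" "m $ i \<in> {- int N..int N}"
    using assms by (auto simp: cube_def)
  then show "(n - m) $ i \<in> {- int (2 * N)..int (2 * N)}"
    by auto
qed

section \<open>Logarithmic divergence of the kernel\<close>

definition riesz_kernel :: "'d \<Rightarrow> int ^ 'd::finite \<Rightarrow> real" where
  "riesz_kernel j m = (real_of_int (m $ j))\<^sup>2 / euclid_norm m ^ (CARD('d) + 2)"

lemma riesz_kernel_nonneg: "0 \<le> riesz_kernel j m"
  by (simp add: riesz_kernel_def euclid_norm_def)

text \<open>
  One face of the cube \<open>{1..k}\<^sup>d\<close>: here \<open>m\<^sub>j\<close> is comparable to \<open>|m|\<close>, so the kernel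
  attains its full size \<open>k\<^bsup>-d\<^esup>\<close>, on \<open>k\<^bsup>d-1\<^esup>\<close> points. Each face therefore contributes about
  \<open>1 / k\<close> to the sum of the kernel.
\<close>

definition face :: "'d \<Rightarrow> nat \<Rightarrow> (int ^ 'd::finite) set" where
  "face j k = {m. \<forall>i. m $ i \<in> (if i = j then {int k} else {1..int k})}"

lemma card_face: "card (face j k :: (int ^ 'd::finite) set) = k ^ (CARD('d) - 1)"
proof -
  have "card (face j k :: (int ^ 'd) set) = (\<Prod>i\<in>UNIV. card (if i = j then {int k} else {1..int k}))"
    unfolding face_def by (rule card_box)
  also have "\<dots> = (\<Prod>i\<in>UNIV. if i = j then 1 else k)"
    by (intro prod.cong) auto
  also have "\<dots> = (\<Prod>i\<in>UNIV - {j}. k)"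
    by (intro prod.mono_neutral_cong_right) auto
  also have "\<dots> = k ^ (CARD('d) - 1)"
    by simp
  finally show ?thesis .
qed

lemma riesz_kernel_face:
  fixes m :: "int ^ 'd::finite"
  assumes "k \<ge> 1" "m \<in> face j k"
  shows "real k ^ 2 / (real CARD('d) * real k) ^ (CARD('d) + 2) \<le> riesz_kernel j m"
proof -
  have mj: "m $ j = int k"
    using assms(2) by (auto simp: face_def dest: spec[of _ j])
  have le: "\<bar>real_of_int (m $ i)\<bar> \<le> real k" for i
    using assms(2) by (auto simp: face_def split: if_splits dest!: spec[of _ i])
  have "euclid_norm m \<le> (\<Sum>i\<in>UNIV. \<bar>real_of_int (m $ i)\<bar>)"
    unfolding euclid_norm_def using norm_le_l1_cart[of "\<chi> i. real_of_int (m $ i)"] by simp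
  also have "\<dots> \<le> real CARD('d) * real k"
    using sum_bounded_above[of UNIV "\<lambda>i. \<bar>real_of_int (m $ i)\<bar>"] le by simp
  finally have upper: "euclid_norm m \<le> real CARD('d) * real k" .
  have "(\<chi> i. real_of_int (m $ i)) \<noteq> 0"
    using mj assms(1) by (auto simp: vec_eq_iff intro!: exI[of _ j])
  then have "0 < euclid_norm m"
    by (simp add: euclid_norm_def)
  moreover have "euclid_norm m ^ (CARD('d) + 2) \<le> (real CARD('d) * real k) ^ (CARD('d) + 2)"
    using upper \<open>0 < euclid_norm m\<close> by (intro power_mono) auto
  ultimately show ?thesis
    unfolding riesz_kernel_def mj of_int_of_nat_eq
    using assms(1) by (intro divide_left_mono mult_pos_pos zero_less_power) auto
qed

lemma kernel_sum_face:
  assumes "k \<ge> 1"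
  shows "inverse (real k) / real CARD('d) ^ (CARD('d) + 2)
    \<le> sum (riesz_kernel j) (face j k :: (int ^ 'd::finite) set)"
proof -
  let ?D = "CARD('d)"
  have *: "real k ^ ?D = real k * real k ^ (?D - 1)"
    by (metis power_minus_mult mult.commute zero_less_card_finite)
  have "inverse (real k) / real ?D ^ (?D + 2)
      = real k ^ (?D - 1) * (real k ^ 2 / (real ?D * real k) ^ (?D + 2))"
    using assms by (simp add: power_mult_distrib power_add * power2_eq_square field_simps)
  also have "\<dots> \<le> sum (riesz_kernel j) (face j k :: (int ^ 'd) set)"
    using sum_bounded_below[of "face j k :: (int ^ 'd) set" _ "riesz_kernel j", OF riesz_kernel_face[OF assms]]
    by (simp add: card_face)
  finally show ?thesis .
qed

text \<open>
  The faces for different \<open>k\<close> are disjoint because \<open>m\<^sub>j = k\<close> on them, so their contributions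
  add up to a multiple of a harmonic number.
\<close>

lemma kernel_sum_unbounded:
  fixes j :: "'d::finite"
  shows "\<exists>N. B < sum (riesz_kernel j) (cube N - {0})"
proof -
  let ?a = "real CARD('d) ^ (CARD('d) + 2)"
  have a: "?a > 0"
    by simp
  obtain N where N: "B * ?a < harm N"
    using filterlim_at_top_dense[THEN iffD1, OF harm_at_top, rule_format, of "B * ?a"]
    by (auto simp: eventually_sequentially)
  have fin: "finite (face j k :: (int ^ 'd) set)" if "k \<ge> 1" for k
    using that by (intro card_ge_0_finite) (simp add: card_face)
  have coord: "m $ j = int k" if "m \<in> face j k" for m :: "int ^ 'd" and k
    using that by (auto simp: face_def dest: spec[of _ j])
  have sub: "(\<Union>k\<in>{1..N}. face j k) \<subseteq> cube N - {0}"
  proof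
    fix m :: "int ^ 'd" assume "m \<in> (\<Union>k\<in>{1..N}. face j k)"
    then obtain k where k: "1 \<le> k" "k \<le> N" "m \<in> face j k"
      by auto
    have "m $ i \<in> {- int N..int N}" for i
      using k by (auto simp: face_def split: if_splits dest!: spec[of _ i])
    then show "m \<in> cube N - {0}"
      using coord[OF k(3)] k(1) by (auto simp: cube_def)
  qed
  have "B < harm N / ?a"
    using N a by (simp add: field_simps)
  also have "\<dots> = (\<Sum>k=1..N. inverse (real k) / ?a)"
    by (simp add: harm_def sum_divide_distrib)
  also have "\<dots> \<le> (\<Sum>k=1..N. sum (riesz_kernel j) (face j k :: (int ^ 'd) set))"
    by (intro sum_mono kernel_sum_face) auto
  also have "\<dots> = sum (riesz_kernel j) (\<Union>k\<in>{1..N}. face j k)"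
    by (subst sum.UNION_disjoint) (use fin in \<open>auto dest!: coord\<close>)
  also have "\<dots> \<le> sum (riesz_kernel j) (cube N - {0})"
    by (intro sum_mono2 sub) (auto simp: finite_cube riesz_kernel_nonneg)
  finally show ?thesis
    by blast
qed

section \<open>Testing the operator on indicators of cubes\<close>

lemma riesz_const_pos: "0 < riesz_const d"
  unfolding riesz_const_def by (intro divide_pos_pos Gamma_real_pos) auto

text \<open>
  For an indicator of a finite set the defining series has finitely many nonzero terms. None
  of them is negative, so those with \<open>m\<close> in the small cube, where the indicator is \<open>1\<close>,
  bound the modulus of the value from below.
\<close>

lemma R_dis_cube_lower:
  fixes j :: "'d::finite"
  assumes "n \<in> cube N"
  shows "riesz_const CARD('d) * sum (riesz_kernel j) (cube N - {0})
    \<le> cmod (R_dis j (indicator (cube (2 * N))) n)"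
proof -
  let ?F = "{m. m \<noteq> 0 \<and> n - m \<in> cube (2 * N)}"
  have "?F \<subseteq> (\<lambda>x. n - x) ` cube (2 * N)"
    by (auto intro!: image_eqI[where x = "n - _"])
  then have fin: "finite ?F"
    using finite_cube finite_surj by blast
  have "(\<Sum>\<^sub>\<infinity>m\<in>UNIV - {0}. of_real ((real_of_int (m $ j))\<^sup>2 / euclid_norm m ^ (CARD('d) + 2))
        * indicator (cube (2 * N)) (n - m))
      = (\<Sum>\<^sub>\<infinity>m\<in>?F. complex_of_real (riesz_kernel j m))"
    by (rule infsum_cong_neutral) (auto simp: riesz_kernel_def)
  also have "\<dots> = complex_of_real (sum (riesz_kernel j) ?F)"
    using fin by simp
  finally have "cmod (R_dis j (indicator (cube (2 * N))) n)
      = riesz_const CARD('d) * sum (riesz_kernel j) ?F"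
    by (simp add: R_dis_def norm_mult less_imp_le[OF riesz_const_pos] sum_nonneg
        riesz_kernel_nonneg abs_of_nonneg del: of_real_sum)
  moreover have "sum (riesz_kernel j) (cube N - {0}) \<le> sum (riesz_kernel j) ?F"
    using fin assms by (intro sum_mono2) (auto simp: riesz_kernel_nonneg diff_in_cube_double)
  ultimately show ?thesis
    by (simp add: mult_left_mono less_imp_le[OF riesz_const_pos])
qed

lemma powr_norm_indicator:
  "cmod (indicator A x) powr p = (if x \<in> A then 1 else 0)"
  by (simp add: indicator_def)

lemma indicator_in_lp_space: "finite A \<Longrightarrow> indicator A \<in> lp_space p"
  unfolding lp_space_def mem_Collect_eq powr_norm_indicator
  by (rule summable_on_cong_neutral[THEN iffD1, OF _ _ _ summable_on_finite[of A "\<lambda>_. 1"]]) auto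

lemma lp_norm_indicator:
  assumes "finite A"
  shows "lp_norm p (indicator A) = real (card A) powr (1 / p)"
proof -
  have "(\<Sum>\<^sub>\<infinity>x. if x \<in> A then 1 else 0 :: real) = (\<Sum>\<^sub>\<infinity>x\<in>A. 1)"
    by (rule infsum_cong_neutral) auto
  then show ?thesis
    using assms by (simp add: lp_norm_def powr_norm_indicator)
qed

lemma lp_norm_lower:
  assumes "p > 0" "g \<in> lp_space p" "finite A" "0 \<le> c" "\<And>x. x \<in> A \<Longrightarrow> c \<le> cmod (g x)"
  shows "c * real (card A) powr (1 / p) \<le> lp_norm p g"
proof -
  have "real (card A) * c powr p \<le> (\<Sum>x\<in>A. cmod (g x) powr p)"
    using assms sum_bounded_below[of A "c powr p" "\<lambda>x. cmod (g x) powr p"]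
    by (simp add: powr_mono2)
  also have "\<dots> \<le> (\<Sum>\<^sub>\<infinity>x. cmod (g x) powr p)"
    using assms by (intro finite_sum_le_infsum) (auto simp: lp_space_def)
  finally have "(real (card A) * c powr p) powr (1 / p) \<le> lp_norm p g"
    unfolding lp_norm_def using assms(1) by (intro powr_mono2) auto
  then show ?thesis
    using assms(1,4) by (simp add: powr_mult powr_powr mult.commute)
qed

lemma weak_l1_norm_lower:
  assumes "finite A" "0 < c" "\<And>x. x \<in> A \<Longrightarrow> c < cmod (g x)"
  shows "ennreal (c * real (card A)) \<le> weak_l1_norm g"
proof -
  have "ennreal (c * real (card A)) = ennreal c * emeasure (count_space UNIV) A"
    using assms by (simp add: ennreal_mult ennreal_of_nat_eq_real_of_nat)
  also have "\<dots> \<le> ennreal c * emeasure (count_space UNIV) {x. cmod (g x) > c}"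
    using assms(3) by (intro mult_left_mono emeasure_mono) auto
  also have "\<dots> \<le> weak_l1_norm g"
    unfolding weak_l1_norm_def using assms(2) by (intro SUP_upper) auto
  finally show ?thesis .
qed

section \<open>Failure of the strong and weak bounds\<close>

lemma not_bounded_on_lp_R_dis:
  fixes j :: "'d::finite"
  assumes "p > 0"
  shows "\<not> bounded_on_lp p (R_dis j)"
proof
  assume "bounded_on_lp p (R_dis j)"
  then obtain C where C: "\<And>f. f \<in> lp_space p \<Longrightarrow> R_dis j f \<in> lp_space p"
      "\<And>f. f \<in> lp_space p \<Longrightarrow> lp_norm p (R_dis j f) \<le> C * lp_norm p f"
    unfolding bounded_on_lp_def by blast
  \<comment> \<open>The value that \<open>C\<close> would impose as a bound on \<open>c\<^sub>d * S N\<close> for all \<open>N\<close>.\<close>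
  define b where "b = \<bar>C\<bar> * (2 ^ CARD('d)) powr (1 / p)"
  obtain N where N: "b / riesz_const CARD('d) < sum (riesz_kernel j) (cube N - {0})"
    using kernel_sum_unbounded by blast
  define s where "s = riesz_const CARD('d) * sum (riesz_kernel j) (cube N - {0})"
  define q where "q = real (card (cube N :: (int ^ 'd) set))"
  let ?f = "indicator (cube (2 * N)) :: int ^ 'd \<Rightarrow> complex"
  have s: "b < s"
    using N riesz_const_pos[of "CARD('d)"] by (simp add: s_def field_simps)
  have q: "q > 0"
    by (simp add: q_def card_cube)
  have f: "?f \<in> lp_space p"
    by (simp add: indicator_in_lp_space finite_cube)
  have "0 \<le> s"
    using s unfolding b_def by (smt (verit) mult_nonneg_nonneg powr_ge_zero)
  then have "s * q powr (1 / p) \<le> lp_norm p (R_dis j ?f)"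
    unfolding q_def using assms C(1)[OF f] finite_cube R_dis_cube_lower
    by (intro lp_norm_lower) (auto simp: s_def)
  also have "\<dots> \<le> C * lp_norm p ?f"
    by (rule C(2)[OF f])
  also have "\<dots> \<le> \<bar>C\<bar> * real (card (cube (2 * N) :: (int ^ 'd) set)) powr (1 / p)"
    by (simp add: lp_norm_indicator finite_cube mult_right_mono)
  also have "\<dots> \<le> \<bar>C\<bar> * (2 ^ CARD('d) * q) powr (1 / p)"
    unfolding q_def using assms card_cube_double[of N, where 'd = 'd]
    by (intro mult_left_mono powr_mono2) auto
  also have "\<dots> = b * q powr (1 / p)"
    using q by (simp add: b_def powr_mult)
  finally have "s \<le> b"
    using q by simp
  with s show False
    by simp
qed

lemma not_bounded_l1_weak_l1_R_dis:
  fixes j :: "'d::finite"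
  shows "\<not> bounded_l1_weak_l1 (R_dis j)"
proof
  assume "bounded_l1_weak_l1 (R_dis j)"
  then obtain C where C: "\<And>f. f \<in> lp_space 1 \<Longrightarrow> weak_l1_norm (R_dis j f) \<le> ennreal (C * lp_norm 1 f)"
    unfolding bounded_l1_weak_l1_def by blast
  \<comment> \<open>The added \<open>1\<close> makes \<open>b\<close> a valid level of the distribution function even if \<open>C = 0\<close>,
    and gives the strict inequality in the final contradiction.\<close>
  define b where "b = \<bar>C\<bar> * 2 ^ CARD('d) + 1"
  obtain N where N: "b / riesz_const CARD('d) < sum (riesz_kernel j) (cube N - {0})"
    using kernel_sum_unbounded by blast
  define q where "q = real (card (cube N :: (int ^ 'd) set))"
  let ?f = "indicator (cube (2 * N)) :: int ^ 'd \<Rightarrow> complex"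
  have s: "b < riesz_const CARD('d) * sum (riesz_kernel j) (cube N - {0})"
    using N riesz_const_pos[of "CARD('d)"] by (simp add: field_simps)
  have q: "q > 0"
    by (simp add: q_def card_cube)
  have b: "b > 0"
    by (simp add: b_def add_nonneg_pos)
  have "ennreal (b * q) \<le> weak_l1_norm (R_dis j ?f)"
    unfolding q_def using b
    by (intro weak_l1_norm_lower finite_cube less_le_trans[OF s R_dis_cube_lower])
  also have "\<dots> \<le> ennreal (C * lp_norm 1 ?f)"
    by (intro C indicator_in_lp_space finite_cube)
  also have "\<dots> \<le> ennreal (\<bar>C\<bar> * real (card (cube (2 * N) :: (int ^ 'd) set)))"
    by (intro ennreal_leI) (simp add: lp_norm_indicator finite_cube mult_right_mono)
  finally have "b * q \<le> \<bar>C\<bar> * real (card (cube (2 * N) :: (int ^ 'd) set))"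
    by (simp add: ennreal_le_iff)
  also have "\<dots> \<le> \<bar>C\<bar> * (2 ^ CARD('d) * q)"
    unfolding q_def by (intro mult_left_mono card_cube_double) auto
  also have "\<dots> < b * q"
    using q by (simp add: b_def algebra_simps)
  finally show False
    by simp
qed

theorem theorem1p3:
  fixes j :: "'d::finite"
  assumes "CARD('d) \<ge> 2"
  shows "(\<forall>p::real. 1 < p \<longrightarrow> \<not> bounded_on_lp p (R_dis j)) \<and>
         \<not> bounded_l1_weak_l1 (R_dis j)"
  by (simp add: not_bounded_on_lp_R_dis not_bounded_l1_weak_l1_R_dis)

end
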